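(* For all integers $n\ge 2$ and $m\ge 1$, the umbrella graph with parameters $n,m$ is a difference graph.
   Context: A graph $G=(V,E)$ is a difference graph if there is a bijection $f$ from $V$ onto a set $S$ of positive integers such that for all distinct $x,y\in V$: $xy\in E$ if and only if $|f(x)-f(y)|\in S$. The umbrella graph with parameters $n,m$ has vertices $u_0,u_1,\dots,u_n,v_0,v_1,\dots,v_m$ and edges: $u_0u_i$ for $1\le i\le n$; $u_{i}u_{i+1}$ for $1\le i\le n-1$; $u_0v_0$; and $v_{j-1}v_j$ for $1\le j\le m$. (That is, a fan with apex $u_0$ over the path $u_1u_2\cdots u_n$, together with a path $u_0v_0v_1\cdots v_m$ attached at the apex.) *)

theory Defs
  imports Main
begin

definition simple_graph :: "'a set \<Rightarrow> 'a set set \<Rightarrow> bool" where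
  "simple_graph V E \<longleftrightarrow> finite V \<and> (\<forall>e\<in>E. e \<subseteq> V \<and> card e = 2)"

text \<open>Labels are taken in \<^typ>\<open>int\<close> rather than \<^typ>\<open>nat\<close> so that the
  difference below is not truncated.\<close>

definition difference_graph :: "'a set \<Rightarrow> 'a set set \<Rightarrow> bool" where
  "difference_graph V E \<longleftrightarrow> simple_graph V E \<and>
     (\<exists>(f :: 'a \<Rightarrow> int) S. S \<subseteq> {0<..} \<and> bij_betw f V S \<and>
        (\<forall>x\<in>V. \<forall>y\<in>V. x \<noteq> y \<longrightarrow> ({x, y} \<in> E \<longleftrightarrow> \<bar>f x - f y\<bar> \<in> S)))"

datatype umbrella_vertex = U nat | V nat

definition umbrella_verts :: "nat \<Rightarrow> nat \<Rightarrow> umbrella_vertex set" where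
  "umbrella_verts n m = U ` {0..n} \<union> V ` {0..m}"

definition umbrella_edges :: "nat \<Rightarrow> nat \<Rightarrow> umbrella_vertex set set" where
  "umbrella_edges n m =
     {{U 0, U i} | i. 1 \<le> i \<and> i \<le> n} \<union>
     {{U i, U (i + 1)} | i. 1 \<le> i \<and> i \<le> n - 1} \<union>
     {{U 0, V 0}} \<union>
     {{V (j - 1), V j} | j. 1 \<le> j \<and> j \<le> m}"

end

theory Submission imports Defs begin

text \<open>Let \<open>d\<close> be large and label \<open>u\<^sub>0\<close> by \<open>d\<close>, \<open>u\<^sub>i\<close> by \<open>i d - 1\<close> and \<open>v\<^sub>j\<close> by \<open>2\<^sup>j\<close>.
  Because \<open>d\<close> is large, an integer is written as \<open>a d + r\<close> with small \<open>r\<close> in at most one way, so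
  differences can be compared coordinatewise.  In the coordinates \<open>(a, r)\<close>, the difference of
  \<open>u\<^sub>0\<close> and \<open>u\<^sub>i\<close> is the label of \<open>u\<^bsub>i-1\<^esub>\<close>, or of \<open>v\<^sub>0\<close> if \<open>i = 1\<close>; that of \<open>u\<^sub>i\<close> and \<open>u\<^sub>k\<close> is
  \<open>(\<bar>i - k\<bar>, 0)\<close>, a label only if \<open>\<bar>i - k\<bar> = 1\<close>; that of \<open>u\<^sub>0\<close> and \<open>v\<^sub>j\<close> is \<open>(1, -2\<^sup>j)\<close>, a label
  only if \<open>j = 0\<close>; that of \<open>u\<^sub>i\<close> and \<open>v\<^sub>j\<close> is \<open>(i, -1 - 2\<^sup>j)\<close>, never a label; and \<open>2\<^sup>k - 2\<^sup>j\<close> is a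
  power of two only if \<open>k = j + 1\<close>.\<close>

text \<open>The large number \<open>d\<close> is \<open>2 ^ (m + 2)\<close>, four times the largest
  tail label \<open>2 ^ m\<close>: remainders of labels and of differences then lie less than
  \<open>d\<close> apart. The apex is an exception, as \<open>i * d - 1\<close> would be negative at
  \<open>i = 0\<close>.\<close>

fun umbrella_label :: "nat \<Rightarrow> umbrella_vertex \<Rightarrow> int" where
  "umbrella_label m (U i) = (if i = 0 then 2 ^ (m + 2) else int i * 2 ^ (m + 2) - 1)"
| "umbrella_label m (V j) = 2 ^ j"

text \<open>The number \<open>s - r\<close> is a multiple of \<open>d\<close> smaller than
  \<open>d\<close> in absolute value, hence zero.\<close>

lemma mult_add_small_unique:
  fixes a b r s d :: int
  assumes "a * d + r = b * d + s" "\<bar>r - s\<bar> < d"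
  shows "a = b \<and> r = s"
proof -
  have "s - r = (a - b) * d" using assms(1) by (simp add: algebra_simps)
  then have "d dvd s - r" by simp
  then have "s - r = 0" using assms(2) dvd_imp_le_int[of "s - r" d] by linarith
  then show ?thesis using assms by auto
qed

text \<open>In \<open>2 ^ k = 2 ^ j + 2 ^ l\<close> both summands are powers of two below
  \<open>2 ^ k\<close>, so each is at most half of it, and therefore exactly half.\<close>

lemma two_power_diff_is_power_iff:
  fixes j k l :: nat
  assumes "j < k"
  shows "(2::int) ^ k - 2 ^ j = 2 ^ l \<longleftrightarrow> k = j + 1 \<and> l = j"
proof
  assume eq: "(2::int) ^ k - 2 ^ j = 2 ^ l"
  have "(2::int) ^ l < 2 ^ k" using eq zero_less_power[of "2::int" j] by linarith
  then have "l < k" by simp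
  then have "(2::int) ^ (l + 1) \<le> 2 ^ k" by (intro power_increasing) auto
  then have "(2::int) ^ l \<le> 2 ^ j" using eq unfolding power_add power_one_right by linarith
  moreover have "(2::int) ^ (j + 1) \<le> 2 ^ k" using assms by (intro power_increasing) auto
  then have "(2::int) ^ j \<le> 2 ^ l" using eq unfolding power_add power_one_right by linarith
  ultimately have "l = j" by simp
  then have "(2::int) ^ k = 2 ^ (j + 1)" using eq by simp
  then have "k = j + 1" by (subst (asm) power_inject_exp) auto
  then show "k = j + 1 \<and> l = j" using \<open>l = j\<close> by blast
qed auto

text \<open>This is the test for being a label in the coordinates \<open>(a, r)\<close>. The bound
  on \<open>r\<close> is just wide enough for the extreme remainder \<open>- 1 - 2 ^ m\<close>,
  which comes from a path vertex of the fan and \<open>V m\<close>.\<close>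

lemma umbrella_label_image_iff:
  fixes a r :: int
  assumes "\<bar>r\<bar> \<le> 2 ^ m + 1"
  shows "a * 2 ^ (m + 2) + r \<in> umbrella_label m ` umbrella_verts n m \<longleftrightarrow>
    a = 1 \<and> r = 0 \<or> 1 \<le> a \<and> a \<le> int n \<and> r = -1 \<or> a = 0 \<and> (\<exists>j\<le>m. r = 2 ^ j)"
    (is "?L \<longleftrightarrow> ?R")
proof
  have pos: "(1::int) \<le> 2 ^ m" by simp
  have d: "(2::int) ^ (m + 2) = 4 * 2 ^ m" by simp
  assume ?L
  \<comment> \<open>The trivial coefficients 0 and 1 stay explicit so that the uniqueness lemma
    applies directly.\<close>
  then consider "a * 2 ^ (m + 2) + r = 1 * 2 ^ (m + 2) + 0"
    | i where "1 \<le> i" "i \<le> n" "a * 2 ^ (m + 2) + r = int i * 2 ^ (m + 2) + (-1)"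
    | j where "j \<le> m" "a * 2 ^ (m + 2) + r = 0 * 2 ^ (m + 2) + 2 ^ j"
    by (auto simp: umbrella_verts_def split: if_splits)
  then show ?R
  proof cases
    case 1
    from mult_add_small_unique[OF this] show ?thesis using assms pos by simp
  next
    case 2
    have "\<bar>r - (-1)\<bar> < 2 ^ (m + 2)" using assms pos d by linarith
    from mult_add_small_unique[OF 2(3) this] show ?thesis using 2(1,2) by simp
  next
    case 3
    have "(2::int) ^ j \<le> 2 ^ m" using 3(1) by simp
    moreover have "(0::int) < 2 ^ j" by simp
    ultimately have "\<bar>r - 2 ^ j\<bar> < 2 ^ (m + 2)" using assms pos d by linarith
    from mult_add_small_unique[OF 3(2) this] show ?thesis using 3(1) by auto
  qed
next
  assume ?R
  then consider "a = 1" "r = 0" | "1 \<le> a" "a \<le> int n" "r = -1" | j where "j \<le> m" "a = 0" "r = 2 ^ j"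
    by blast
  then show ?L
  proof cases
    case 1
    then show ?thesis by (intro image_eqI[of _ _ "U 0"]) (auto simp: umbrella_verts_def)
  next
    case 2
    then show ?thesis
      by (intro image_eqI[of _ _ "U (nat a)"]) (auto simp: umbrella_verts_def nat_le_iff)
  next
    case 3
    then show ?thesis by (intro image_eqI[of _ _ "V j"]) (auto simp: umbrella_verts_def)
  qed
qed

lemma umbrella_label_pos: "umbrella_label m x > 0"
proof (cases x)
  case (U i)
  show ?thesis
  proof (cases "i = 0")
    case False
    have "(1::int) < 2 ^ (m + 2)" by (rule one_less_power) auto
    also have "int 1 * 2 ^ (m + 2) \<le> int i * 2 ^ (m + 2)"
      using False by (intro mult_right_mono) auto
    then have "2 ^ (m + 2) \<le> int i * 2 ^ (m + 2)" by simp
    finally show ?thesis using False U by simp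
  qed (simp add: U)
qed simp

text \<open>The remainder reveals the kind of vertex: 0 for the apex, -1 for the other
  \<open>U i\<close>, positive for the tail.\<close>

lemma inj_on_umbrella_label: "inj_on (umbrella_label m) (umbrella_verts n m)"
proof (rule inj_onI)
  let ?d = "2 ^ (m + 2) :: int"
  have pw: "1 \<le> (2::int) ^ j \<and> 2 * 2 ^ j < ?d" if "j \<le> m" for j
  proof -
    have "(2::int) ^ j \<le> 2 ^ m" using that by simp
    moreover have "(2::int) ^ (m + 2) = 4 * 2 ^ m" by simp
    moreover have "(1::int) \<le> 2 ^ j" by simp
    ultimately show ?thesis by linarith
  qed
  have d: "2 < ?d" using pw[of 0] by simp
  have U: "\<exists>a r. umbrella_label m (U i) = a * ?d + r \<and> -1 \<le> r \<and> r \<le> 0 \<and>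
      a = (if i = 0 then 1 else int i) \<and> r = (if i = 0 then 0 else - 1)" for i
    by simp
  have UV: "umbrella_label m (U i) \<noteq> umbrella_label m (V j)" if "j \<le> m" for i j
  proof
    assume "umbrella_label m (U i) = umbrella_label m (V j)"
    with U[of i] obtain a r where "a * ?d + r = 0 * ?d + 2 ^ j" "-1 \<le> r" "r \<le> 0" by auto
    with mult_add_small_unique[of a ?d r 0 "2 ^ j"] pw[OF that] show False by linarith
  qed
  have UU: "i = k" if eq: "umbrella_label m (U i) = umbrella_label m (U k)" for i k
  proof -
    obtain a r where 1: "umbrella_label m (U i) = a * ?d + r" "-1 \<le> r" "r \<le> 0"
      "a = (if i = 0 then 1 else int i)" "r = (if i = 0 then 0 else - 1)" using U by blast
    obtain b s where 2: "umbrella_label m (U k) = b * ?d + s" "-1 \<le> s" "s \<le> 0"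
      "b = (if k = 0 then 1 else int k)" "s = (if k = 0 then 0 else - 1)" using U by blast
    have "a * ?d + r = b * ?d + s" using eq 1(1) 2(1) by (simp only:)
    then have "a = b \<and> r = s" by (rule mult_add_small_unique) (use 1(2,3) 2(2,3) d in linarith)
    \<comment> \<open>\<open>U 0\<close> and \<open>U 1\<close> share the coefficient 1; only the
      remainder separates them.\<close>
    then show ?thesis using 1(4,5) 2(4,5) by (auto split: if_splits)
  qed
  fix x y assume "x \<in> umbrella_verts n m" "y \<in> umbrella_verts n m"
    "umbrella_label m x = umbrella_label m y"
  then show "x = y"
    using UV UV[symmetric] UU
    by (cases x; cases y) (auto simp: umbrella_verts_def simp del: umbrella_label.simps(1))
qed

lemma umbrella_edges_iff:
  "{U 0, U i} \<in> umbrella_edges n m \<longleftrightarrow> 1 \<le> i \<and> i \<le> n"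
  "1 \<le> i \<Longrightarrow> i < k \<Longrightarrow> {U i, U k} \<in> umbrella_edges n m \<longleftrightarrow> k = i + 1 \<and> k \<le> n"
  "{U i, V j} \<in> umbrella_edges n m \<longleftrightarrow> i = 0 \<and> j = 0"
  by (auto simp: umbrella_edges_def doubleton_eq_iff)

lemma umbrella_edges_tail_iff:
  assumes "j < l"
  shows "{V j, V l} \<in> umbrella_edges n m \<longleftrightarrow> l = j + 1 \<and> l \<le> m"
proof -
  have "{V j, V l} \<in> umbrella_edges n m \<longleftrightarrow> (\<exists>i. {V j, V l} = {V (i - 1), V i} \<and> 1 \<le> i \<and> i \<le> m)"
    by (auto simp: umbrella_edges_def doubleton_eq_iff)
  also have "\<dots> \<longleftrightarrow> l = j + 1 \<and> l \<le> m"
  proof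
    assume "l = j + 1 \<and> l \<le> m"
    then show "\<exists>i. {V j, V l} = {V (i - 1), V i} \<and> 1 \<le> i \<and> i \<le> m" by (intro exI[of _ l]) simp
  qed (use assms in \<open>auto simp: doubleton_eq_iff\<close>)
  finally show ?thesis .
qed

lemma simple_graph_umbrella:
  assumes "n \<ge> 1"
  shows "simple_graph (umbrella_verts n m) (umbrella_edges n m)"
proof -
  \<comment> \<open>Subtraction is truncated, so at \<open>j = 0\<close> this set would be a
    singleton.\<close>
  have "card {V (j - 1), V j} = 2" if "1 \<le> j" for j using that by (simp add: card_insert_if)
  moreover have "card {U 0, U i} = 2" if "1 \<le> i" for i using that by (simp add: card_insert_if)
  ultimately show ?thesis
    using assms by (auto simp: simple_graph_def umbrella_verts_def umbrella_edges_def)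
qed

text \<open>Both sides are symmetric, so four kinds of pairs remain: \<open>apex\<close>,
  \<open>path\<close>, \<open>mixed\<close> and \<open>tail\<close>. Membership of a difference is
  mostly decided by the coordinate test.\<close>

lemma umbrella_edge_iff_label_diff:
  assumes n: "n \<ge> 1"
    and x: "x \<in> umbrella_verts n m" and y: "y \<in> umbrella_verts n m" and xy: "x \<noteq> y"
  shows "{x, y} \<in> umbrella_edges n m \<longleftrightarrow>
    \<bar>umbrella_label m x - umbrella_label m y\<bar> \<in> umbrella_label m ` umbrella_verts n m"
proof -
  let ?f = "umbrella_label m" and ?S = "umbrella_label m ` umbrella_verts n m"
  let ?d = "2 ^ (m + 2) :: int"
  let ?P = "\<lambda>x y. {x, y} \<in> umbrella_edges n m \<longleftrightarrow> \<bar>?f x - ?f y\<bar> \<in> ?S"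
  have sym: "?P x y \<longleftrightarrow> ?P y x" for x y by (simp add: insert_commute abs_minus_commute)
  have one: "(1::int) \<le> 2 ^ m" by simp
  have d: "?d = 4 * 2 ^ m" by simp
  have pw: "1 \<le> (2::int) ^ j \<and> (2::int) ^ j \<le> 2 ^ m" if "j \<le> m" for j using that by simp
  have apex: "?P (U 0) (U i)" if i: "1 \<le> i" "i \<le> n" for i
  \<comment> \<open>The case \<open>i = 1\<close> is separate because its predecessor
    \<open>U 0\<close> does not follow the formula \<open>i * d - 1\<close>.\<close>
  proof (cases "i = 1")
    case True
    have "\<bar>?f (U 0) - ?f (U i)\<bar> = 0 * ?d + 1" using True by simp
    moreover have "0 * ?d + 1 \<in> ?S"
      by (subst umbrella_label_image_iff) (auto intro: exI[of _ 0])
    ultimately show ?thesis using i by (simp add: umbrella_edges_iff(1))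
  next
    case False
    then have "?f (U i) - ?f (U 0) = (int i - 1) * ?d + (-1)" using i by (simp add: algebra_simps)
    moreover have "?f (U (i - 1)) = (int i - 1) * ?d + (-1)"
      using False i by simp
    \<comment> \<open>The signed difference is itself a label, hence positive.\<close>
    ultimately have "\<bar>?f (U 0) - ?f (U i)\<bar> = ?f (U (i - 1))"
      using umbrella_label_pos[of m "U (i - 1)"] by linarith
    moreover have "U (i - 1) \<in> umbrella_verts n m" using i by (simp add: umbrella_verts_def)
    ultimately have "\<bar>?f (U 0) - ?f (U i)\<bar> \<in> ?S" by (simp only: imageI)
    then show ?thesis using i by (simp add: umbrella_edges_iff(1) del: umbrella_label.simps)
  qed
  have path: "?P (U i) (U k)" if ik: "1 \<le> i" "i < k" "k \<le> n" for i k
  proof -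
    have "?f (U k) - ?f (U i) = (int k - int i) * ?d + 0" using ik by (simp add: algebra_simps)
    moreover have "0 \<le> (int k - int i) * ?d + 0" using ik by simp
    ultimately have eq: "\<bar>?f (U i) - ?f (U k)\<bar> = (int k - int i) * ?d + 0" by linarith
    \<comment> \<open>Only the apex label has remainder 0, which forces the coefficient 1.\<close>
    have "\<bar>?f (U i) - ?f (U k)\<bar> \<in> ?S \<longleftrightarrow> k = i + 1"
      unfolding eq by (subst umbrella_label_image_iff) (use ik in auto)
    then show ?thesis using ik by (simp add: umbrella_edges_iff(2))
  qed
  have mixed: "?P (U i) (V j)" if ij: "i \<le> n" "j \<le> m" for i j
  proof (cases "i = 0")
    case True
    have "?f (U i) = ?d" "?f (V j) = 2 ^ j" using True by simp_all
    then have "\<bar>?f (U i) - ?f (V j)\<bar> = 1 * ?d + (- (2 ^ j))" using pw[OF ij(2)] one d by linarith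
    \<comment> \<open>For \<open>j = 0\<close> the difference is \<open>d - 1\<close>, the label of
      \<open>U 1\<close>, which is a vertex because \<open>n\<close> is at least 1.\<close>
    moreover have "1 * ?d + (- (2 ^ j)) \<in> ?S \<longleftrightarrow> j = 0"
    proof -
      have "\<bar>- (2 ^ j) :: int\<bar> \<le> 2 ^ m + 1" using pw[OF ij(2)] by linarith
      moreover have "(2::int) ^ j = 1 \<longleftrightarrow> j = 0" using power_inject_exp[of "2::int" j 0] by simp
      ultimately show ?thesis by (subst umbrella_label_image_iff) (use n in auto)
    qed
    ultimately show ?thesis using True by (simp add: umbrella_edges_iff(3))
  next
    case False
    have "1 * ?d \<le> int i * ?d" using False by (intro mult_right_mono) auto
    moreover have "?f (U i) = int i * ?d - 1" "?f (V j) = 2 ^ j" using False by simp_all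
    ultimately have "\<bar>?f (U i) - ?f (V j)\<bar> = int i * ?d + (- 1 - 2 ^ j)"
      using pw[OF ij(2)] one d by linarith
    \<comment> \<open>This remainder is at most -2, below that of every label.\<close>
    moreover have "int i * ?d + (- 1 - 2 ^ j) \<notin> ?S"
    proof -
      have "\<bar>- 1 - 2 ^ j :: int\<bar> \<le> 2 ^ m + 1" using pw[OF ij(2)] by linarith
      moreover have "- 1 - 2 ^ j \<noteq> (2::int) ^ l" for l
        using pw[OF ij(2)] zero_less_power[of "2::int" l] by linarith
      moreover have "- 1 \<noteq> (2::int) ^ j" using pw[OF ij(2)] by linarith
      ultimately show ?thesis by (subst umbrella_label_image_iff) (use False in auto)
    qed
    ultimately show ?thesis using False by (simp add: umbrella_edges_iff(3))
  qed
  have tail: "?P (V j) (V l)" if jl: "j < l" "l \<le> m" for j l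
  proof -
    have le: "(2::int) ^ j \<le> 2 ^ l" using jl by simp
    then have eq: "\<bar>?f (V j) - ?f (V l)\<bar> = 0 * ?d + (2 ^ l - 2 ^ j)" by simp
    have "\<bar>2 ^ l - 2 ^ j :: int\<bar> \<le> 2 ^ m + 1" using le pw[of j] pw[of l] jl by linarith
    then have "\<bar>?f (V j) - ?f (V l)\<bar> \<in> ?S \<longleftrightarrow> (\<exists>i\<le>m. (2::int) ^ l - 2 ^ j = 2 ^ i)"
      unfolding eq by (subst umbrella_label_image_iff) auto
    \<comment> \<open>The exponent found is \<open>j\<close> itself, which respects the bound
      \<open>m\<close> since \<open>j < l\<close>.\<close>
    also have "\<dots> \<longleftrightarrow> l = j + 1" using jl by (auto simp: two_power_diff_is_power_iff)
    finally show ?thesis using jl by (simp add: umbrella_edges_tail_iff)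
  qed
  show ?thesis
  proof (cases x; cases y)
    fix i k assume *: "x = U i" "y = U k"
    then have "i \<le> n" "k \<le> n" "i \<noteq> k" using x y xy by (auto simp: umbrella_verts_def)
    then consider "i = 0" "1 \<le> k" | "k = 0" "1 \<le> i" | "1 \<le> i" "i < k" | "1 \<le> k" "k < i" by linarith
    then show ?thesis
    proof cases
      case 1
      show ?thesis unfolding * 1(1) using 1(2) \<open>k \<le> n\<close> by (rule apex)
    next
      case 2
      show ?thesis unfolding * 2(1) sym[of "U i"] using 2(2) \<open>i \<le> n\<close> by (rule apex)
    next
      case 3
      show ?thesis unfolding * using 3 \<open>k \<le> n\<close> by (rule path)
    next
      case 4
      show ?thesis unfolding * sym[of "U i"] using 4 \<open>i \<le> n\<close> by (rule path)
    qed
  next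
    fix i j assume *: "x = U i" "y = V j"
    then have "i \<le> n" "j \<le> m" using x y by (auto simp: umbrella_verts_def)
    then show ?thesis unfolding * by (rule mixed)
  next
    fix i j assume *: "x = V j" "y = U i"
    then have "i \<le> n" "j \<le> m" using x y by (auto simp: umbrella_verts_def)
    then show ?thesis unfolding * sym[of "V j"] by (rule mixed)
  next
    fix j l assume *: "x = V j" "y = V l"
    then have "j \<le> m" "l \<le> m" and "j < l \<or> l < j" using x y xy by (auto simp: umbrella_verts_def)
    from this(3) show ?thesis
    proof
      assume "j < l"
      then show ?thesis unfolding * using \<open>l \<le> m\<close> by (rule tail)
    next
      assume "l < j"
      then show ?thesis unfolding * sym[of "V j"] using \<open>j \<le> m\<close> by (rule tail)
    qed
  qed
qed

theorem theorem3p5: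
  fixes n m :: nat
  assumes "n \<ge> 2" and "m \<ge> 1"
  shows "difference_graph (umbrella_verts n m) (umbrella_edges n m)"
proof -
  let ?S = "umbrella_label m ` umbrella_verts n m"
  have n: "n \<ge> 1" using assms(1) by simp
  have "?S \<subseteq> {0<..}" using umbrella_label_pos by auto
  moreover have "bij_betw (umbrella_label m) (umbrella_verts n m) ?S"
    using inj_on_umbrella_label by (rule inj_on_imp_bij_betw)
  ultimately show ?thesis
    unfolding difference_graph_def
    using simple_graph_umbrella[OF n] umbrella_edge_iff_label_diff[OF n]
    by (intro conjI exI[of _ "umbrella_label m"] exI[of _ ?S] ballI impI)
qed

end
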